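(* Let $G=(V,E)$ be a connected finite graph with positive symmetric edge weights $w_{xy}$ and a measure $\mu:V\to\mathbb{R}^{+}$, and let $h:V\to\mathbb{R}$ be a positive function. Let $$\mathbf{H}=\left\{u\in \mathbf{W}^{1,2}(V)\;\Big|\;\int_V u\,d\mu=0\right\},\qquad J_{\alpha,\beta}(u)=\frac12\int_V\left(|\nabla u|^2-\alpha u^2\right)d\mu-\beta\log\int_V he^u\,d\mu .$$ Let $\lambda_1(V)$ be the first non-zero eigenvalue of $-\Delta$, let $E_1=E_{\lambda_1(V)}$ be its eigenspace with orthonormal basis $\{u_{1i}\}_{i=1}^{n_1}$, and let $E_1^{\perp}=\{u\in\mathbf{H}\mid\int_V uv\,d\mu=0\ \ \forall v\in E_1\}$. Then: (i) If $\alpha>\lambda_1(V)$, then for any $\beta\in\mathbb{R}$, $\inf_{u\in\mathbf{H}}J_{\alpha,\beta}(u)=-\infty$. (ii) If $\alpha=\lambda_1(V)$, then: (ii-a) for any $\beta>0$, $\inf_{u\in\mathbf{H}}J_{\lambda_1(V),\beta}(u)=-\infty$; (ii-b) $J_{\lambda_1(V),0}$ has a minimizer in $\mathbf{H}$ (i.e. attains its infimum over $\mathbf{H}$), so that the Kazdan-Warner equation $$\Delta u+\alpha u=-\frac{\beta he^{u}}{\int_V he^{u}\,d\mu}+\frac{\beta}{\mathrm{Vol}(V)}\quad\text{on }V$$ with $\alpha=\lambda_1(V)$ and $\beta=0$ has a solution $u\in\mathbf{H}$; (ii-c) for any $\beta<0$, $J_{\lambda_1(V),\beta}$ has a minimizer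 in $E_1^{\perp}$ (i.e. attains its infimum over $E_1^{\perp}$), so that the Kazdan-Warner equation $$\Delta u+\alpha u=-\frac{\beta he^{u}}{\int_V he^{u}\,d\mu}+\frac{\beta}{\mathrm{Vol}(V)}+\sum_{i=1}^{n_1}\frac{\beta\int_V hu_{1i}e^{u}\,d\mu}{\int_V he^{u}\,d\mu}\,u_{1i}\quad\text{on }V$$ with $\alpha=\lambda_1(V)$ has a solution $u\in E_1^{\perp}$.
   Context: $G=(V,E)$ is a finite connected graph (with at least two vertices, so that $-\Delta$ has a non-zero eigenvalue); each edge $xy\in E$ has a weight $w_{xy}>0$ with $w_{xy}=w_{yx}$; $y\sim x$ means $xy\in E$; $\mu:V\to\mathbb{R}^{+}$ is a positive finite measure. For $u:V\to\mathbb{R}$, $$\Delta u(x)=\frac{1}{\mu(x)}\sum_{y\sim x}w_{xy}[u(y)-u(x)],\qquad |\nabla u|(x)=\left\{\frac{1}{2\mu(x)}\sum_{y\sim x}w_{xy}[u(y)-u(x)]^2\right\}^{1/2}.$$ For $g:V\to\mathbb{R}$, $\int_V g\,d\mu=\sum_{x\in V}\mu(x)g(x)$, and $\mathrm{Vol}(V)=\sum_{x\in V}\mu(x)$. The Sobolev space is $\mathbf{W}^{1,2}(V)=\{u:V\to\mathbb{R}\mid\int_V(|\nabla u|^2+u^2)\,d\mu<+\infty\}$ (since $V$ is finite, this is the space of all functions on $V$). The first non-zero eigenvalue is $$\lambda_1(V)=\inf_{u\in\mathbf{H},\ \int_V u^2\,d\mu=1}\int_V|\nabla u|^2\,d\mu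 ,$$ and $E_{\lambda_1(V)}=\{u:V\to\mathbb{R}\mid-\Delta u=\lambda_1(V)u\}$, of dimension $n_1$. Orthonormality is with respect to the inner product $\int_V uv\,d\mu$. *)

theory Defs
  imports Complex_Main "HOL-Library.Extended_Real"
begin

text \<open>
  The vertex set \<open>V\<close> of a finite graph is the whole of a finite type \<open>'v\<close>, and \<open>E x y\<close> says that
  \<open>xy\<close> is an edge. Loops are not excluded; they contribute nothing to the Laplacian or the
  gradient. The weight \<open>w x y\<close> is only meaningful, and only constrained, on edges.
\<close>

locale weighted_graph =
  fixes E :: "'v::finite \<Rightarrow> 'v \<Rightarrow> bool"
    and w :: "'v \<Rightarrow> 'v \<Rightarrow> real"
    and \<mu> :: "'v \<Rightarrow> real"
  assumes edge_sym: "symp E"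
    and connected: "rtranclp E x y"
    and two_vertices: "2 \<le> card (UNIV :: 'v set)"
    and weight_pos: "E x y \<Longrightarrow> 0 < w x y"
    and weight_sym: "E x y \<Longrightarrow> w x y = w y x"
    and measure_pos: "0 < \<mu> x"

definition laplacian ::
  "('v::finite \<Rightarrow> 'v \<Rightarrow> bool) \<Rightarrow> ('v \<Rightarrow> 'v \<Rightarrow> real) \<Rightarrow> ('v \<Rightarrow> real) \<Rightarrow> ('v \<Rightarrow> real) \<Rightarrow> 'v \<Rightarrow> real"
  where "laplacian E w \<mu> u x = (1 / \<mu> x) * (\<Sum>y | E x y. w x y * (u y - u x))"

definition grad_norm ::
  "('v::finite \<Rightarrow> 'v \<Rightarrow> bool) \<Rightarrow> ('v \<Rightarrow> 'v \<Rightarrow> real) \<Rightarrow> ('v \<Rightarrow> real) \<Rightarrow> ('v \<Rightarrow> real) \<Rightarrow> 'v \<Rightarrow> real"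
  where "grad_norm E w \<mu> u x = sqrt (1 / (2 * \<mu> x) * (\<Sum>y | E x y. w x y * (u y - u x)\<^sup>2))"

definition vint :: "('v::finite \<Rightarrow> real) \<Rightarrow> ('v \<Rightarrow> real) \<Rightarrow> real"
  where "vint \<mu> g = (\<Sum>x\<in>UNIV. \<mu> x * g x)"

definition vol :: "('v::finite \<Rightarrow> real) \<Rightarrow> real"
  where "vol \<mu> = (\<Sum>x\<in>UNIV. \<mu> x)"

text \<open>The finiteness condition is automatic because the graph is finite.\<close>

definition sobolev_space ::
  "('v::finite \<Rightarrow> 'v \<Rightarrow> bool) \<Rightarrow> ('v \<Rightarrow> 'v \<Rightarrow> real) \<Rightarrow> ('v \<Rightarrow> real) \<Rightarrow> ('v \<Rightarrow> real) set"
  where "sobolev_space E w \<mu> = {u. ereal (vint \<mu> (\<lambda>x. (grad_norm E w \<mu> u x)\<^sup>2 + (u x)\<^sup>2)) < \<infinity>}"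

definition mean_zero_space ::
  "('v::finite \<Rightarrow> 'v \<Rightarrow> bool) \<Rightarrow> ('v \<Rightarrow> 'v \<Rightarrow> real) \<Rightarrow> ('v \<Rightarrow> real) \<Rightarrow> ('v \<Rightarrow> real) set"
  where "mean_zero_space E w \<mu> = {u \<in> sobolev_space E w \<mu>. vint \<mu> u = 0}"

definition lambda1 ::
  "('v::finite \<Rightarrow> 'v \<Rightarrow> bool) \<Rightarrow> ('v \<Rightarrow> 'v \<Rightarrow> real) \<Rightarrow> ('v \<Rightarrow> real) \<Rightarrow> real"
  where "lambda1 E w \<mu> =
    (INF u \<in> {u \<in> mean_zero_space E w \<mu>. vint \<mu> (\<lambda>x. (u x)\<^sup>2) = 1}.
       vint \<mu> (\<lambda>x. (grad_norm E w \<mu> u x)\<^sup>2))"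

definition eigenspace ::
  "('v::finite \<Rightarrow> 'v \<Rightarrow> bool) \<Rightarrow> ('v \<Rightarrow> 'v \<Rightarrow> real) \<Rightarrow> ('v \<Rightarrow> real) \<Rightarrow> real \<Rightarrow> ('v \<Rightarrow> real) set"
  where "eigenspace E w \<mu> l = {u. \<forall>x. - laplacian E w \<mu> u x = l * u x}"

definition E1 ::
  "('v::finite \<Rightarrow> 'v \<Rightarrow> bool) \<Rightarrow> ('v \<Rightarrow> 'v \<Rightarrow> real) \<Rightarrow> ('v \<Rightarrow> real) \<Rightarrow> ('v \<Rightarrow> real) set"
  where "E1 E w \<mu> = eigenspace E w \<mu> (lambda1 E w \<mu>)"

definition E1_perp ::
  "('v::finite \<Rightarrow> 'v \<Rightarrow> bool) \<Rightarrow> ('v \<Rightarrow> 'v \<Rightarrow> real) \<Rightarrow> ('v \<Rightarrow> real) \<Rightarrow> ('v \<Rightarrow> real) set"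
  where "E1_perp E w \<mu> =
    {u \<in> mean_zero_space E w \<mu>. \<forall>v \<in> E1 E w \<mu>. vint \<mu> (\<lambda>x. u x * v x) = 0}"

text \<open>
  The family \<open>b 1, \<dots>, b n\<close> is an orthonormal basis of \<open>W\<close> in \<open>L\<^sup>2(\<mu>)\<close>; linear independence
  follows from orthonormality.
\<close>

definition orthonormal_basis ::
  "('v::finite \<Rightarrow> real) \<Rightarrow> ('v \<Rightarrow> real) set \<Rightarrow> nat \<Rightarrow> (nat \<Rightarrow> 'v \<Rightarrow> real) \<Rightarrow> bool"
  where "orthonormal_basis \<mu> W n b \<longleftrightarrow>
    (\<forall>i\<in>{1..n}. b i \<in> W) \<and>
    (\<forall>i\<in>{1..n}. \<forall>j\<in>{1..n}. vint \<mu> (\<lambda>x. b i x * b j x) = (if i = j then 1 else 0)) \<and>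
    (\<forall>v\<in>W. \<exists>c :: nat \<Rightarrow> real. \<forall>x. v x = (\<Sum>i=1..n. c i * b i x))"

definition J ::
  "('v::finite \<Rightarrow> 'v \<Rightarrow> bool) \<Rightarrow> ('v \<Rightarrow> 'v \<Rightarrow> real) \<Rightarrow> ('v \<Rightarrow> real) \<Rightarrow> ('v \<Rightarrow> real)
    \<Rightarrow> real \<Rightarrow> real \<Rightarrow> ('v \<Rightarrow> real) \<Rightarrow> real"
  where "J E w \<mu> h \<alpha> \<beta> u =
    1 / 2 * vint \<mu> (\<lambda>x. (grad_norm E w \<mu> u x)\<^sup>2 - \<alpha> * (u x)\<^sup>2)
      - \<beta> * ln (vint \<mu> (\<lambda>x. h x * exp (u x)))"

end

theory Submission
  imports Defs "HOL-Analysis.Function_Topology"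
begin

text \<open>
  Write \<open>\<lambda>\<close> for the first eigenvalue, \<open>\<langle>u, v\<rangle>\<close> for \<open>\<integral> u v d\<mu>\<close>, \<open>Z(u)\<close> for \<open>\<integral> h e\<^sup>u d\<mu>\<close> and
  \<open>Q(u, v) = \<langle>- \<Delta>u - \<lambda>u, v\<rangle>\<close>. By Green's formula \<open>Q\<close> is symmetric, and
  \<open>J(u) = (Q(u, u) + (\<lambda> - \<alpha>) \<langle>u, u\<rangle>) / 2 - \<beta> ln Z(u)\<close>. Everything rests on three properties of \<open>Q\<close>.

  First, the \<open>L\<^sup>2\<close> unit sphere of the mean-zero functions is compact, because the function space is
  finite dimensional, so the Rayleigh infimum is attained (\<open>exists_rayleigh_minimizer\<close>). Hence \<open>Q\<close> is
  nonnegative on mean-zero functions. Secondly, a mean-zero \<open>u\<close> with \<open>Q(u, u) = 0\<close> minimizes \<open>Q\<close>, so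
  its first variation vanishes and it is an eigenfunction (\<open>qform_eq_0_imp_E1\<close>); in particular the
  first eigenspace is not zero. Thirdly, on the orthogonal complement of that eigenspace \<open>Q\<close> is
  therefore strictly positive, and by compactness of the sphere again it dominates a positive
  multiple of \<open>\<langle>u, u\<rangle>\<close> (\<open>spectral_gap_E1_perp\<close>).

  Along a ray \<open>t v\<close> through a normalized eigenfunction the quadratic part of \<open>J\<close> is
  \<open>t\<^sup>2 (\<lambda> - \<alpha>) / 2\<close>, whereas \<open>ln Z(t v)\<close> grows at most linearly in \<open>t\<close>, and at least linearly, since
  \<open>v\<close> is positive somewhere. For \<open>\<alpha> > \<lambda>\<close> the quadratic term drives \<open>J\<close> to \<open>-\<infinity>\<close> whatever the sign of
  \<open>\<beta>\<close>; for \<open>\<alpha> = \<lambda>\<close> it vanishes, and \<open>- \<beta> ln Z(t v)\<close> does so if \<open>\<beta> > 0\<close>. For \<open>\<alpha> = \<lambda>\<close> and \<open>\<beta> = 0\<close> the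
  functional is \<open>Q(u, u) / 2 \<ge> 0\<close>, with minimizer \<open>0\<close>.

  For \<open>\<alpha> = \<lambda>\<close> and \<open>\<beta> < 0\<close>, a mean-zero \<open>u\<close> is nonnegative at some vertex, which bounds \<open>ln Z(u)\<close> from
  below; with the spectral gap this makes \<open>J\<close> coercive on the complement, and a minimizer \<open>u\<close>
  exists (\<open>J_attains_min_E1_perp\<close>). Its first variation says that
  \<open>g = \<Delta>u + \<lambda>u + \<beta> h e\<^sup>u / Z(u)\<close> is orthogonal to every function of the complement, so \<open>g\<close> is a
  combination of the constants and the first eigenfunctions. The coefficients of this combination are
  the extra terms of the Kazdan-Warner equation.
\<close>

section \<open>Facts about functions and real numbers\<close>

text \<open>
  A bounded set of functions lies in a cube, and cubes are compact by Tychonoff's theorem for the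
  product topology on functions.
\<close>

lemma compact_bounded_functions:
  fixes S :: "('v::finite \<Rightarrow> real) set"
  assumes "closed S" and "\<And>u x. u \<in> S \<Longrightarrow> \<bar>u x\<bar> \<le> R"
  shows "compact S"
proof -
  have "compact (PiE UNIV (\<lambda>_. {-R..R}) :: ('v \<Rightarrow> real) set)"
    using compactin_PiE[of "\<lambda>_::'v. euclidean :: real topology" UNIV "\<lambda>_. {-R..R}"]
    by (simp add: euclidean_product_topology)
  moreover have "S \<subseteq> PiE UNIV (\<lambda>_. {-R..R})"
    using assms(2) by (auto simp: PiE_def Pi_def abs_le_iff minus_le_iff)
  ultimately show ?thesis
    using assms(1) compact_Int_closed[of "PiE UNIV (\<lambda>_. {-R..R})" S] by (simp add: inf.absorb2)
qed

lemma INF_ereal_eq_minf: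
  assumes "\<And>K. \<exists>u\<in>S. f u \<le> K"
  shows "(INF u\<in>S. ereal (f u)) = -\<infinity>"
proof -
  have "(INF u\<in>S. ereal (f u)) \<le> ereal K" for K
    using assms[of K] by (meson INF_lower2 ereal_less_eq(3))
  then show ?thesis
    using ereal_bot by blast
qed

lemma nonneg_quadratic_imp_linear_0:
  fixes b c :: real
  assumes "\<And>t. 0 \<le> 2 * t * b + t\<^sup>2 * c"
  shows "b = 0"
proof -
  have "((\<lambda>t. 2 * t * b + t\<^sup>2 * c) has_real_derivative 2 * b) (at 0)"
    by (auto intro!: derivative_eq_intros)
  from DERIV_local_min[OF this, of 1] assms show ?thesis by simp
qed

section \<open>Integration against the measure\<close>

lemma vint_linear:
  "vint \<mu> (\<lambda>x. f x + g x) = vint \<mu> f + vint \<mu> g"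
  "vint \<mu> (\<lambda>x. f x - g x) = vint \<mu> f - vint \<mu> g"
  "vint \<mu> (\<lambda>x. c * f x) = c * vint \<mu> f"
  "vint \<mu> (\<lambda>x. f x / c) = vint \<mu> f / c"
  "vint \<mu> (\<lambda>x. - f x) = - vint \<mu> f"
  "vint \<mu> (\<lambda>x. 0) = 0"
  by (simp_all add: vint_def sum.distrib sum_subtractf sum_distrib_left sum_divide_distrib
      sum_negf algebra_simps)

lemma vint_sum: "vint \<mu> (\<lambda>x. \<Sum>i\<in>I. f i x) = (\<Sum>i\<in>I. vint \<mu> (f i))"
  by (simp add: vint_def sum_distrib_left) (rule sum.swap)

lemma vint_const: "vint \<mu> (\<lambda>x. c) = c * vol \<mu>"
  by (simp add: vint_def vol_def sum_distrib_left mult.commute)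

lemma continuous_vint:
  assumes "\<And>x. continuous_on A (\<lambda>u. f u x)"
  shows "continuous_on A (\<lambda>u. vint \<mu> (f u))"
  unfolding vint_def by (intro continuous_intros assms)

lemma continuous_coordinate: "continuous_on A (\<lambda>u :: 'v \<Rightarrow> real. u x)"
  by (rule continuous_on_subset[OF continuous_on_product_coordinates]) simp

lemma continuous_laplacian:
  "continuous_on A (\<lambda>u. laplacian E w \<mu> u x)"
  unfolding laplacian_def by (intro continuous_intros continuous_coordinate)

context weighted_graph
begin

lemma vol_pos: "0 < vol \<mu>"
  unfolding vol_def by (rule sum_pos) (auto simp: measure_pos)

lemma vint_nonneg: "(\<And>x. 0 \<le> f x) \<Longrightarrow> 0 \<le> vint \<mu> f"
  unfolding vint_def by (intro sum_nonneg mult_nonneg_nonneg) (auto simp: less_imp_le measure_pos)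

lemma vint_ge_term:
  assumes "\<And>x. 0 \<le> f x"
  shows "\<mu> x * f x \<le> vint \<mu> f"
  unfolding vint_def
  by (rule member_le_sum) (auto intro!: mult_nonneg_nonneg simp: assms less_imp_le measure_pos)

lemma vint_pos: "(\<And>x. 0 < f x) \<Longrightarrow> 0 < vint \<mu> f"
  unfolding vint_def by (rule sum_pos) (auto simp: measure_pos)

lemma vint_mono: "(\<And>x. f x \<le> g x) \<Longrightarrow> vint \<mu> f \<le> vint \<mu> g"
  unfolding vint_def by (intro sum_mono mult_left_mono) (auto simp: less_imp_le measure_pos)

lemma vint_square_eq_0D:
  assumes "vint \<mu> (\<lambda>x. (f x)\<^sup>2) = 0"
  shows "f x = 0"
proof -
  have "\<mu> x * (f x)\<^sup>2 \<le> 0"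
    using vint_ge_term[of "\<lambda>x. (f x)\<^sup>2" x] assms by simp
  then show ?thesis
    using measure_pos[of x] by (simp add: mult_le_0_iff)
qed

text \<open>
  One vertex with \<open>u x \<ge> 0\<close> already bounds \<open>\<integral> h e\<^sup>u d\<mu>\<close> from below, by \<open>\<mu> x * h x\<close>.
\<close>

lemma mean_zero_nonneg_vertex:
  assumes "vint \<mu> u = 0"
  obtains x where "0 \<le> u x"
  using vint_pos[of "\<lambda>x. - u x"] assms by (force simp: vint_linear not_le[symmetric])

lemma mean_zero_pos_vertex:
  assumes "vint \<mu> u = 0" and "u y \<noteq> 0"
  obtains x where "0 < u x"
proof (rule ccontr)
  assume "\<not> thesis"
  then have "\<And>x. 0 \<le> - u x"
    using that not_le_imp_less by fastforce
  from vint_ge_term[of "\<lambda>x. - u x" y, OF this] this[of y] measure_pos[of y] assms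
  show False by (auto simp: vint_linear mult_less_0_iff zero_le_mult_iff)
qed

text \<open>
  On a finite graph every function belongs to the Sobolev space.
\<close>

lemma mean_zero_space_eq: "mean_zero_space E w \<mu> = {u. vint \<mu> u = 0}"
  by (simp add: mean_zero_space_def sobolev_space_def)

text \<open>
  The form of the direct method used throughout: an \<open>L\<^sup>2\<close> bound is a pointwise bound, because the
  measure is bounded away from zero on a finite vertex set.
\<close>

lemma attains_min_square_bounded:
  fixes f :: "('v \<Rightarrow> real) \<Rightarrow> real"
  assumes "closed S" "S \<noteq> {}" "\<And>u. u \<in> S \<Longrightarrow> vint \<mu> (\<lambda>x. (u x)\<^sup>2) \<le> R" "continuous_on UNIV f"
  obtains u where "u \<in> S" "\<And>v. v \<in> S \<Longrightarrow> f u \<le> f v"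
proof -
  define m where "m = Min (range \<mu>)"
  have m: "0 < m" "\<And>x. m \<le> \<mu> x"
    unfolding m_def by (auto simp: measure_pos)
  have "\<bar>u x\<bar> \<le> sqrt (R / m)" if "u \<in> S" for u x
  proof -
    have "m * (u x)\<^sup>2 \<le> \<mu> x * (u x)\<^sup>2"
      using m by (intro mult_right_mono) auto
    also have "\<dots> \<le> R"
      using vint_ge_term[of "\<lambda>x. (u x)\<^sup>2" x] assms(3)[OF that] by simp
    finally have "(u x)\<^sup>2 \<le> R / m"
      using m by (simp add: field_simps)
    then show ?thesis
      using real_sqrt_le_mono by fastforce
  qed
  then have "compact S"
    using assms(1) compact_bounded_functions by blast
  then show thesis
    using continuous_attains_inf[of S f] assms(2,4) continuous_on_subset that by blast
qed

section \<open>Green's formula and the Dirichlet form\<close>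

text \<open>
  The polarization of the energy \<open>\<integral> |\<nabla>u|\<^sup>2 d\<mu>\<close>, as \<open>dirichlet_grad_norm\<close> shows; written as
  the pairing of \<open>- \<Delta>u\<close> with \<open>v\<close>, from which Euler-Lagrange equations can be read off.
\<close>

definition dirichlet :: "('v \<Rightarrow> real) \<Rightarrow> ('v \<Rightarrow> real) \<Rightarrow> real"
  where "dirichlet u v = vint \<mu> (\<lambda>x. - laplacian E w \<mu> u x * v x)"

text \<open>
  Summation by parts: exchanging the names of the end points of an edge changes the sign of
  \<open>u y - u x\<close>, so twice the left-hand side is the sum over both orientations.
\<close>

lemma green:
  "dirichlet u v = 1/2 * (\<Sum>x\<in>UNIV. \<Sum>y | E x y. w x y * (u y - u x) * (v y - v x))"
proof -
  \<comment> \<open>Extending the weights by zero makes the summation range independent of the vertex, so that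
    the two sums can be exchanged.\<close>
  define W where "W x y = (if E x y then w x y else 0)" for x y
  have W_sym: "W x y = W y x" for x y
    using edge_sym weight_sym by (auto simp: W_def symp_def)
  have restrict: "(\<Sum>y | E x y. w x y * f y) = (\<Sum>y\<in>UNIV. W x y * f y)" for x f
    unfolding W_def by (rule sum.mono_neutral_cong_left) auto
  have "dirichlet u v = (\<Sum>x\<in>UNIV. \<Sum>y\<in>UNIV. W x y * (u x - u y) * v x)"
    unfolding dirichlet_def vint_def laplacian_def restrict
    using less_imp_neq[OF measure_pos]
    by (intro sum.cong refl) (auto simp: sum_distrib_left sum_distrib_right algebra_simps
        simp flip: sum_negf intro!: sum.cong)
  moreover have "\<dots> = (\<Sum>x\<in>UNIV. \<Sum>y\<in>UNIV. W x y * (u y - u x) * v y)"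
    by (subst sum.swap) (simp add: W_sym)
  ultimately have "2 * dirichlet u v = (\<Sum>x\<in>UNIV. \<Sum>y\<in>UNIV. W x y * (u y - u x) * (v y - v x))"
  proof -
    have "W x y * (u y - u x) * (v y - v x)
        = W x y * (u x - u y) * v x + W x y * (u y - u x) * v y" for x y
      by (simp add: algebra_simps)
    then show ?thesis
      using \<open>dirichlet u v = _\<close> \<open>_ = (\<Sum>x\<in>UNIV. \<Sum>y\<in>UNIV. W x y * (u y - u x) * v y)\<close>
      by (simp add: sum.distrib)
  qed
  then show ?thesis
    using restrict[of _ "\<lambda>y. (u y - u x) * (v y - v x)" for x] by (simp add: mult.assoc)
qed

lemma dirichlet_commute: "dirichlet u v = dirichlet v u"
  by (simp add: green mult_ac)

lemma dirichlet_grad_norm: "vint \<mu> (\<lambda>x. (grad_norm E w \<mu> u x)\<^sup>2) = dirichlet u u"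
proof -
  have "\<mu> x * (grad_norm E w \<mu> u x)\<^sup>2 = 1/2 * (\<Sum>y | E x y. w x y * (u y - u x)\<^sup>2)" for x
  proof -
    have "0 \<le> 1 / (2 * \<mu> x) * (\<Sum>y | E x y. w x y * (u y - u x)\<^sup>2)"
      by (intro mult_nonneg_nonneg sum_nonneg) (auto simp: less_imp_le measure_pos weight_pos)
    then show ?thesis
      using measure_pos[of x] by (simp add: grad_norm_def)
  qed
  then show ?thesis
    by (simp add: vint_def green power2_eq_square mult.assoc sum_distrib_left)
qed

lemma vint_laplacian: "vint \<mu> (laplacian E w \<mu> u) = 0"
  using green[of u "\<lambda>_. 1"] by (simp add: dirichlet_def vint_linear)

text \<open>
  Zero energy makes a function equal at the end points of each edge; connectedness does the rest.
\<close>

lemma dirichlet_eq_0_imp_const: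
  assumes "dirichlet u u = 0"
  shows "u x = u y"
proof -
  have nn: "0 \<le> (\<Sum>y | E x y. w x y * (u y - u x) * (u y - u x))" for x
    by (auto intro!: sum_nonneg simp: mult.assoc less_imp_le weight_pos)
  have "\<forall>x\<in>UNIV. (\<Sum>y | E x y. w x y * (u y - u x) * (u y - u x)) = 0"
    using assms nn by (subst sum_nonneg_eq_0_iff[symmetric]) (auto simp: green)
  then have "\<forall>y\<in>{y. E x y}. w x y * (u y - u x) * (u y - u x) = 0" for x
    by (subst sum_nonneg_eq_0_iff[symmetric]) (auto simp: mult.assoc less_imp_le weight_pos)
  then have edge: "E x y \<Longrightarrow> u x = u y" for x y
    using weight_pos[of x y] by fastforce
  from connected[of x y] show ?thesis
    by (induction rule: rtranclp_induct) (auto dest: edge)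
qed

section \<open>The first eigenvalue\<close>

abbreviation lam :: real
  where "lam \<equiv> lambda1 E w \<mu>"

text \<open>
  The unit sphere of the mean-zero functions is compact, and it is not empty because there are two
  distinct vertices.
\<close>

lemma exists_rayleigh_minimizer:
  obtains \<phi> where "vint \<mu> \<phi> = 0" "vint \<mu> (\<lambda>x. (\<phi> x)\<^sup>2) = 1" "dirichlet \<phi> \<phi> = lam"
    "\<And>u. vint \<mu> u = 0 \<Longrightarrow> vint \<mu> (\<lambda>x. (u x)\<^sup>2) = 1 \<Longrightarrow> lam \<le> dirichlet u u"
proof -
  define S where "S = {u :: 'v \<Rightarrow> real. vint \<mu> u = 0 \<and> vint \<mu> (\<lambda>x. (u x)\<^sup>2) = 1}"
  have "closed S"
    unfolding S_def
    by (intro closed_Collect_conj closed_Collect_eq continuous_vint continuous_intros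
        continuous_coordinate)
  moreover have "S \<noteq> {}"
  proof -
    obtain a b :: 'v where "a \<noteq> b"
      using two_vertices card_le_Suc0_iff_eq[of "UNIV :: 'v set"] by auto
    \<comment> \<open>Two opposite point masses of equal size.\<close>
    define f where "f x = (if x = a then 1 / \<mu> a else 0) - (if x = b then 1 / \<mu> b else 0)" for x
    have pos: "\<mu> a \<noteq> 0" "\<mu> b \<noteq> 0"
      using measure_pos less_imp_neq by metis+
    have "\<mu> x * f x = (if x = a then 1 else 0) - (if x = b then 1 else 0)" for x
      using pos by (auto simp: f_def)
    then have mean: "vint \<mu> f = 0"
      by (simp add: vint_def sum_subtractf)
    define N where "N = vint \<mu> (\<lambda>x. (f x)\<^sup>2)"
    have "N \<noteq> 0"
      using vint_square_eq_0D[of f a] \<open>a \<noteq> b\<close> pos by (auto simp: N_def f_def)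
    moreover have "0 \<le> N"
      unfolding N_def by (rule vint_nonneg) simp
    ultimately have "(\<lambda>x. f x / sqrt N) \<in> S"
      using mean by (simp add: S_def vint_linear power_divide flip: N_def)
    then show ?thesis by blast
  qed
  moreover have "continuous_on UNIV (\<lambda>u. dirichlet u u)"
    unfolding dirichlet_def
    by (intro continuous_vint continuous_intros continuous_laplacian continuous_coordinate)
  ultimately obtain \<phi> where \<phi>: "\<phi> \<in> S" "\<And>v. v \<in> S \<Longrightarrow> dirichlet \<phi> \<phi> \<le> dirichlet v v"
    using attains_min_square_bounded[of S 1 "\<lambda>u. dirichlet u u"] by (auto simp: S_def)
  have "lam = (INF u\<in>S. dirichlet u u)"
    by (simp add: lambda1_def mean_zero_space_eq dirichlet_grad_norm S_def)
  also have "\<dots> = dirichlet \<phi> \<phi>"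
    using \<phi> by (intro cInf_eq_minimum) auto
  finally show thesis
    using \<phi> that[of \<phi>] by (simp add: S_def)
qed

text \<open>
  A minimizer with zero energy would be constant, hence zero because of its mean.
\<close>

lemma lambda1_pos: "0 < lam"
proof -
  obtain \<phi> where \<phi>: "vint \<mu> \<phi> = 0" "vint \<mu> (\<lambda>x. (\<phi> x)\<^sup>2) = 1" "dirichlet \<phi> \<phi> = lam"
    by (rule exists_rayleigh_minimizer)
  have "lam \<noteq> 0"
  proof
    assume "lam = 0"
    then have const: "\<phi> = (\<lambda>x. \<phi> (SOME x. True))"
      using dirichlet_eq_0_imp_const[of \<phi>] \<phi>(3) by auto
    then have "\<phi> (SOME x. True) * vol \<mu> = 0"
      using \<phi>(1) vint_const by metis
    then have "\<phi> = (\<lambda>x. 0)"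
      using const vol_pos by auto
    then show False
      using \<phi>(2) by (simp add: vint_linear)
  qed
  moreover have "0 \<le> lam"
    unfolding \<phi>(3)[symmetric] dirichlet_grad_norm[symmetric] by (rule vint_nonneg) simp
  ultimately show ?thesis by simp
qed

text \<open>
  The integral of a Laplacian vanishes, so \<open>\<lambda> \<integral> v d\<mu> = 0\<close> for an eigenfunction, and \<open>\<lambda> > 0\<close>.
\<close>

lemma E1_mean_zero:
  assumes "v \<in> E1 E w \<mu>"
  shows "vint \<mu> v = 0"
proof -
  have "laplacian E w \<mu> v = (\<lambda>x. - lam * v x)"
    using assms by (auto simp: E1_def eigenspace_def fun_eq_iff minus_equation_iff eq_commute)
  then have "- lam * vint \<mu> v = 0"
    using vint_laplacian[of v] by (simp add: vint_linear)
  then show ?thesis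
    using lambda1_pos by simp
qed

text \<open>
  The symmetric form of \<open>- \<Delta> - \<lambda>\<close> for the first eigenvalue \<open>\<lambda>\<close>, which is twice the quadratic part of
  the functional at \<open>\<alpha> = \<lambda>\<close>.
\<close>

definition qform :: "('v \<Rightarrow> real) \<Rightarrow> ('v \<Rightarrow> real) \<Rightarrow> real"
  where "qform u v = dirichlet u v - lam * vint \<mu> (\<lambda>x. u x * v x)"

lemma qform_eq: "qform u v = - vint \<mu> (\<lambda>x. (laplacian E w \<mu> u x + lam * u x) * v x)"
  by (simp add: qform_def dirichlet_def distrib_right mult.assoc vint_linear)

lemma qform_commute: "qform u v = qform v u"
  using dirichlet_commute[of u v] by (simp add: qform_def mult.commute)

lemma qform_add_right: "qform u (\<lambda>x. v x + t * z x) = qform u v + t * qform u z"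
  by (simp add: qform_eq distrib_left vint_linear mult.left_commute[of _ t])

lemma qform_expand:
  "qform (\<lambda>x. u x + t * v x) (\<lambda>x. u x + t * v x) = qform u u + 2 * t * qform u v + t\<^sup>2 * qform v v"
proof -
  have "qform (\<lambda>x. u x + t * v x) (\<lambda>x. u x + t * v x)
      = qform u (\<lambda>x. u x + t * v x) + t * qform v (\<lambda>x. u x + t * v x)"
    by (simp add: qform_add_right qform_commute[of "\<lambda>x. u x + t * v x"])
  then show ?thesis
    using qform_commute[of v u] by (simp add: qform_add_right power2_eq_square algebra_simps)
qed

lemma qform_scale: "qform (\<lambda>x. t * u x) (\<lambda>x. t * u x) = t\<^sup>2 * qform u u"
  using qform_expand[of "\<lambda>x. 0" t u] by (simp add: qform_eq vint_linear laplacian_def)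

lemma continuous_qform: "continuous_on A (\<lambda>u. qform u u)"
  unfolding qform_eq
  by (intro continuous_vint continuous_intros continuous_laplacian continuous_coordinate)

lemma normalize_square:
  assumes "vint \<mu> (\<lambda>x. (u x)\<^sup>2) \<noteq> 0"
  obtains s where "0 < s" "s\<^sup>2 = vint \<mu> (\<lambda>x. (u x)\<^sup>2)" "vint \<mu> (\<lambda>x. (1 / s * u x)\<^sup>2) = 1"
proof
  have "0 \<le> vint \<mu> (\<lambda>x. (u x)\<^sup>2)"
    by (rule vint_nonneg) simp
  then show "0 < sqrt (vint \<mu> (\<lambda>x. (u x)\<^sup>2))"
    "(sqrt (vint \<mu> (\<lambda>x. (u x)\<^sup>2)))\<^sup>2 = vint \<mu> (\<lambda>x. (u x)\<^sup>2)"
    "vint \<mu> (\<lambda>x. (1 / sqrt (vint \<mu> (\<lambda>x. (u x)\<^sup>2)) * u x)\<^sup>2) = 1"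
    using assms by (simp_all add: power_divide vint_linear)
qed

text \<open>
  The variational characterization of the first eigenvalue, freed from its normalization.
\<close>

lemma qform_nonneg:
  assumes "vint \<mu> u = 0"
  shows "0 \<le> qform u u"
proof (cases "vint \<mu> (\<lambda>x. (u x)\<^sup>2) = 0")
  case True
  then have "u x = 0" for x
    by (rule vint_square_eq_0D)
  then show ?thesis
    by (simp add: qform_eq vint_linear)
next
  case False
  then obtain s where s: "0 < s" "s\<^sup>2 = vint \<mu> (\<lambda>x. (u x)\<^sup>2)" "vint \<mu> (\<lambda>x. (1 / s * u x)\<^sup>2) = 1"
    by (rule normalize_square)
  define z where "z x = 1 / s * u x" for x
  obtain \<phi> where "\<And>u. vint \<mu> u = 0 \<Longrightarrow> vint \<mu> (\<lambda>x. (u x)\<^sup>2) = 1 \<Longrightarrow> lam \<le> dirichlet u u"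
    by (rule exists_rayleigh_minimizer) blast
  moreover have "vint \<mu> z = 0"
    unfolding z_def vint_linear(3) using assms by simp
  ultimately have "0 \<le> qform z z"
    using s(3) by (simp add: z_def qform_def flip: power2_eq_square)
  moreover have "qform u u = s\<^sup>2 * qform z z"
    using s(1) qform_scale[of s z] by (simp add: z_def)
  ultimately show ?thesis by simp
qed

text \<open>
  Such a \<open>u\<close> minimizes the nonnegative form, so the first variation at \<open>u\<close> vanishes in all mean-zero
  directions. One of these is the residual \<open>g = \<Delta>u + \<lambda>u\<close> itself, for which the variation is
  \<open>- \<integral> g\<^sup>2 d\<mu>\<close>.
\<close>

lemma qform_eq_0_imp_E1:
  assumes "vint \<mu> u = 0" and "qform u u = 0"
  shows "u \<in> E1 E w \<mu>"
proof -
  define g where "g x = laplacian E w \<mu> u x + lam * u x" for x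
  have "vint \<mu> g = 0"
    using assms(1) vint_laplacian[of u] by (simp add: g_def[abs_def] vint_linear)
  then have "vint \<mu> (\<lambda>x. u x + t * g x) = 0" for t
    using assms(1) by (simp add: vint_linear)
  then have "0 \<le> 2 * t * qform u g + t\<^sup>2 * qform g g" for t
    using qform_nonneg[of "\<lambda>x. u x + t * g x"] qform_expand[of u t g] assms(2) by simp
  then have "qform u g = 0"
    by (rule nonneg_quadratic_imp_linear_0)
  then have "vint \<mu> (\<lambda>x. (g x)\<^sup>2) = 0"
    by (simp add: qform_eq g_def power2_eq_square)
  then have "g x = 0" for x
    by (rule vint_square_eq_0D)
  then show ?thesis
    by (auto simp: g_def E1_def eigenspace_def neg_eq_iff_add_eq_0)
qed

lemma qform_E1: "v \<in> E1 E w \<mu> \<Longrightarrow> qform v u = 0"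
  by (simp add: qform_eq E1_def eigenspace_def neg_eq_iff_add_eq_0 vint_linear)

lemma exists_first_eigenfunction:
  obtains v where "v \<in> E1 E w \<mu>" "vint \<mu> v = 0" "vint \<mu> (\<lambda>x. (v x)\<^sup>2) = 1"
proof -
  obtain \<phi> where \<phi>: "vint \<mu> \<phi> = 0" "vint \<mu> (\<lambda>x. (\<phi> x)\<^sup>2) = 1" "dirichlet \<phi> \<phi> = lam"
    by (rule exists_rayleigh_minimizer)
  have "qform \<phi> \<phi> = 0"
    using \<phi>(2,3) by (simp add: qform_def power2_eq_square)
  then show thesis
    using \<phi> that qform_eq_0_imp_E1 by blast
qed

lemma E1_perp_eq: "E1_perp E w \<mu> = {u. vint \<mu> u = 0 \<and> (\<forall>v\<in>E1 E w \<mu>. vint \<mu> (\<lambda>x. u x * v x) = 0)}"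
  by (auto simp: E1_perp_def mean_zero_space_eq)

lemma closed_E1_perp: "closed (E1_perp E w \<mu>)"
proof -
  have "E1_perp E w \<mu> = {u. vint \<mu> u = 0} \<inter> (\<Inter>v\<in>E1 E w \<mu>. {u. vint \<mu> (\<lambda>x. u x * v x) = 0})"
    by (auto simp: E1_perp_eq)
  then show ?thesis
    by (simp only:) (intro closed_Int closed_INT ballI closed_Collect_eq continuous_vint
        continuous_intros continuous_coordinate)
qed

lemma E1_perp_add: "u \<in> E1_perp E w \<mu> \<Longrightarrow> v \<in> E1_perp E w \<mu> \<Longrightarrow> (\<lambda>x. u x + t * v x) \<in> E1_perp E w \<mu>"
  by (simp add: E1_perp_eq vint_linear distrib_right mult.assoc)

lemma zero_in_E1_perp: "(\<lambda>x. 0) \<in> E1_perp E w \<mu>"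
  by (simp add: E1_perp_eq vint_linear)

text \<open>
  The form attains its minimum on the unit sphere of the complement. If that minimum were zero, the
  minimizer would be an eigenfunction orthogonal to itself.
\<close>

lemma spectral_gap_E1_perp:
  obtains c where "0 < c" "\<And>u. u \<in> E1_perp E w \<mu> \<Longrightarrow> c * vint \<mu> (\<lambda>x. (u x)\<^sup>2) \<le> qform u u"
proof -
  define S where "S = {u \<in> E1_perp E w \<mu>. vint \<mu> (\<lambda>x. (u x)\<^sup>2) = 1}"
  have closed: "closed S"
    unfolding S_def Collect_conj_eq Collect_mem_eq
    by (intro closed_Int closed_E1_perp closed_Collect_eq continuous_vint continuous_intros
        continuous_coordinate)
  obtain c where c: "0 < c" "\<And>u. u \<in> S \<Longrightarrow> c \<le> qform u u"
  proof (cases "S = {}")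
    \<comment> \<open>The complement is trivial when all mean-zero functions are first eigenfunctions, as on the
      complete graph with equal weights and equal masses.\<close>
    case True
    then show thesis
      using that[of 1] by simp
  next
    case False
    then obtain \<phi> where \<phi>: "\<phi> \<in> S" "\<And>v. v \<in> S \<Longrightarrow> qform \<phi> \<phi> \<le> qform v v"
      using attains_min_square_bounded[OF closed False, of 1 "\<lambda>u. qform u u"] continuous_qform
      by (auto simp: S_def)
    have "qform \<phi> \<phi> \<noteq> 0"
    proof
      assume "qform \<phi> \<phi> = 0"
      then have "\<phi> \<in> E1 E w \<mu>"
        using \<phi>(1) qform_eq_0_imp_E1 by (auto simp: S_def E1_perp_eq)
      then have "vint \<mu> (\<lambda>x. \<phi> x * \<phi> x) = 0"
        using \<phi>(1) by (auto simp: S_def E1_perp_eq)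
      then show False
        using \<phi>(1) by (simp add: S_def power2_eq_square)
    qed
    moreover have "0 \<le> qform \<phi> \<phi>"
      using \<phi>(1) qform_nonneg by (auto simp: S_def E1_perp_eq)
    ultimately show thesis
      using that[of "qform \<phi> \<phi>"] \<phi>(2) by fastforce
  qed
  have "c * vint \<mu> (\<lambda>x. (u x)\<^sup>2) \<le> qform u u" if u: "u \<in> E1_perp E w \<mu>" for u
  proof (cases "vint \<mu> (\<lambda>x. (u x)\<^sup>2) = 0")
    case True
    then show ?thesis
      using qform_nonneg u by (simp add: E1_perp_eq)
  next
    case False
    then obtain s where s: "0 < s" "s\<^sup>2 = vint \<mu> (\<lambda>x. (u x)\<^sup>2)" "vint \<mu> (\<lambda>x. (1 / s * u x)\<^sup>2) = 1"
      by (rule normalize_square)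
    define z where "z x = 1 / s * u x" for x
    have "z \<in> S"
      using s(3) E1_perp_add[OF zero_in_E1_perp u, of "1 / s"] by (simp add: S_def z_def[abs_def])
    then have "s\<^sup>2 * c \<le> s\<^sup>2 * qform z z"
      using c(2) by (simp add: mult_left_mono)
    moreover have "qform u u = s\<^sup>2 * qform z z"
      using s(1) qform_scale[of s z] by (simp add: z_def)
    ultimately show ?thesis
      using s(2) by (simp add: mult.commute)
  qed
  then show thesis
    using that c(1) by blast
qed

section \<open>The functional along an eigenfunction\<close>

lemma J_eq:
  "J E w \<mu> h \<alpha> \<beta> u = 1/2 * (qform u u + (lam - \<alpha>) * vint \<mu> (\<lambda>x. (u x)\<^sup>2))
    - \<beta> * ln (vint \<mu> (\<lambda>x. h x * exp (u x)))"
  by (simp add: J_def vint_linear dirichlet_grad_norm qform_def left_diff_distrib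
      flip: power2_eq_square)

lemma J_scaled_eigenfunction:
  assumes "v \<in> E1 E w \<mu>" "vint \<mu> (\<lambda>x. (v x)\<^sup>2) = 1"
  shows "J E w \<mu> h \<alpha> \<beta> (\<lambda>x. t * v x)
    = t\<^sup>2 * (lam - \<alpha>) / 2 - \<beta> * ln (vint \<mu> (\<lambda>x. h x * exp (t * v x)))"
  using assms by (simp add: J_eq qform_scale qform_E1 power_mult_distrib vint_linear)

lemma ln_partition_ge:
  assumes "\<And>x. 0 < h x"
  shows "ln (\<mu> x * h x) + u x \<le> ln (vint \<mu> (\<lambda>x. h x * exp (u x)))"
proof -
  have "ln (\<mu> x * h x) + u x = ln (\<mu> x * (h x * exp (u x)))"
    using assms[of x] measure_pos[of x] by (simp add: ln_mult)
  also have "\<dots> \<le> ln (vint \<mu> (\<lambda>x. h x * exp (u x)))"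
    using assms measure_pos vint_ge_term[of "\<lambda>x. h x * exp (u x)" x]
    by (intro ln_mono) (auto simp: less_imp_le)
  finally show ?thesis .
qed

lemma ln_partition_le:
  assumes "\<And>x. 0 < h x" "\<And>x. u x \<le> M"
  shows "ln (vint \<mu> (\<lambda>x. h x * exp (u x))) \<le> ln (vint \<mu> h) + M"
proof -
  have pos: "0 < vint \<mu> h" "0 < vint \<mu> (\<lambda>x. h x * exp (u x))"
    using assms(1) by (simp_all add: vint_pos)
  have "vint \<mu> (\<lambda>x. h x * exp (u x)) \<le> vint \<mu> (\<lambda>x. exp M * h x)"
    using assms by (intro vint_mono) (simp add: mult.commute mult_left_mono less_imp_le)
  then have "ln (vint \<mu> (\<lambda>x. h x * exp (u x))) \<le> ln (exp M * vint \<mu> h)"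
    using pos by (intro ln_mono) (simp_all add: vint_linear)
  then show ?thesis
    using pos by (simp add: ln_mult)
qed

text \<open>
  The term \<open>t\<^sup>2 (\<lambda> - \<alpha>) / 2\<close> beats the logarithm, which on the ray \<open>t v\<close> is bounded in absolute value
  by a linear function of \<open>t\<close>.
\<close>

lemma J_unbounded_supercritical:
  assumes "\<And>x. 0 < h x" "lam < \<alpha>"
  shows "\<exists>u\<in>mean_zero_space E w \<mu>. J E w \<mu> h \<alpha> \<beta> u \<le> K"
proof -
  obtain v where v: "v \<in> E1 E w \<mu>" "vint \<mu> v = 0" "vint \<mu> (\<lambda>x. (v x)\<^sup>2) = 1"
    by (rule exists_first_eigenfunction)
  obtain x where x: "0 \<le> v x"
    using mean_zero_nonneg_vertex v(2) by blast
  define M where "M = Max (range v)"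
  have M: "v y \<le> M" for y
    by (simp add: M_def)
  define A where "A = \<bar>\<beta>\<bar> * (\<bar>ln (\<mu> x * h x)\<bar> + \<bar>ln (vint \<mu> h)\<bar>)"
  define B where "B = (\<alpha> - lam) / 2"
  define C where "C = \<bar>\<beta>\<bar> * M"
  have B: "0 < B"
    using assms(2) by (simp add: B_def)
  have nn: "0 \<le> A" "0 \<le> C"
    using x M[of x] by (simp_all add: A_def C_def)
  have bound: "J E w \<mu> h \<alpha> \<beta> (\<lambda>x. t * v x) \<le> A + C * t - B * t\<^sup>2" if t: "0 \<le> t" for t
  proof -
    let ?l = "ln (vint \<mu> (\<lambda>x. h x * exp (t * v x)))"
    have "ln (\<mu> x * h x) + t * v x \<le> ?l"
      using ln_partition_ge[of h x "\<lambda>x. t * v x"] assms(1) by simp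
    moreover have "?l \<le> ln (vint \<mu> h) + t * M"
      using ln_partition_le[of h "\<lambda>x. t * v x" "t * M"] assms(1) M t by (simp add: mult_left_mono)
    moreover have "0 \<le> t * v x" "0 \<le> t * M"
      using x t M[of x] by auto
    ultimately have "\<bar>?l\<bar> \<le> \<bar>ln (\<mu> x * h x)\<bar> + \<bar>ln (vint \<mu> h)\<bar> + t * M"
      by linarith
    then have "\<bar>\<beta>\<bar> * \<bar>?l\<bar> \<le> \<bar>\<beta>\<bar> * (\<bar>ln (\<mu> x * h x)\<bar> + \<bar>ln (vint \<mu> h)\<bar> + t * M)"
      by (rule mult_left_mono) simp
    moreover have "- (\<beta> * ?l) \<le> \<bar>\<beta>\<bar> * \<bar>?l\<bar>"
      by (metis abs_ge_minus_self abs_mult)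
    ultimately show ?thesis
      using J_scaled_eigenfunction[OF v(1,3), of h \<alpha> \<beta> t]
      by (simp add: A_def B_def C_def field_simps)
  qed
  \<comment> \<open>Chosen so that \<open>B t - C \<ge> \<bar>K\<bar> + A\<close>, and \<open>t \<ge> 1\<close> keeps this bound after multiplication by \<open>t\<close>.\<close>
  define t where "t = 1 + (\<bar>K\<bar> + A + C) / B"
  have t: "1 \<le> t"
    using B nn by (simp add: t_def)
  have "B * t - C \<ge> \<bar>K\<bar> + A"
    using B by (simp add: t_def field_simps)
  then have "t * (B * t - C) \<ge> 1 * (\<bar>K\<bar> + A)"
    using t nn by (intro mult_mono) auto
  then have "A + C * t - B * t\<^sup>2 \<le> K"
    by (simp add: power2_eq_square algebra_simps)
  then have "J E w \<mu> h \<alpha> \<beta> (\<lambda>x. t * v x) \<le> K"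
    using bound[of t] t by linarith
  moreover have "(\<lambda>x. t * v x) \<in> mean_zero_space E w \<mu>"
    using v(2) by (simp add: mean_zero_space_eq vint_linear)
  ultimately show ?thesis by blast
qed

text \<open>
  The quadratic part vanishes on eigenfunctions, and a vertex with \<open>v x > 0\<close> makes the logarithm grow
  linearly along \<open>t v\<close>.
\<close>

lemma J_unbounded_critical:
  assumes "\<And>x. 0 < h x" "0 < \<beta>"
  shows "\<exists>u\<in>mean_zero_space E w \<mu>. J E w \<mu> h lam \<beta> u \<le> K"
proof -
  obtain v where v: "v \<in> E1 E w \<mu>" "vint \<mu> v = 0" "vint \<mu> (\<lambda>x. (v x)\<^sup>2) = 1"
    by (rule exists_first_eigenfunction)
  obtain y where "v y \<noteq> 0"
    using v(3) by (force simp: vint_linear)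
  then obtain x where x: "0 < v x"
    using mean_zero_pos_vertex v(2) by blast
  define t where "t = (- K / \<beta> - ln (\<mu> x * h x)) / v x"
  have "- K / \<beta> \<le> ln (vint \<mu> (\<lambda>x. h x * exp (t * v x)))"
    using ln_partition_ge[of h x "\<lambda>x. t * v x"] assms(1) x by (simp add: t_def)
  then have "J E w \<mu> h lam \<beta> (\<lambda>x. t * v x) \<le> K"
    using assms(2) J_scaled_eigenfunction[OF v(1,3), of h lam \<beta> t] by (simp add: field_simps)
  moreover have "(\<lambda>x. t * v x) \<in> mean_zero_space E w \<mu>"
    using v(2) by (simp add: mean_zero_space_eq vint_linear)
  ultimately show ?thesis by blast
qed

section \<open>Minimizers on the orthogonal complement of the first eigenspace\<close>

text \<open>
  Coercivity: the quadratic part is bounded below by the spectral gap, and \<open>- \<beta> ln Z\<close> by a constant,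
  since \<open>- \<beta> > 0\<close> and \<open>u\<close> is nonnegative at some vertex. Hence sublevel sets are bounded in \<open>L\<^sup>2\<close>.
\<close>

lemma J_attains_min_E1_perp:
  assumes h: "\<And>x. 0 < h x" and "\<beta> < 0"
  obtains u where "u \<in> E1_perp E w \<mu>" "\<And>v. v \<in> E1_perp E w \<mu> \<Longrightarrow> J E w \<mu> h lam \<beta> u \<le> J E w \<mu> h lam \<beta> v"
proof -
  let ?J = "J E w \<mu> h lam \<beta>"
  obtain c where c: "0 < c" "\<And>u. u \<in> E1_perp E w \<mu> \<Longrightarrow> c * vint \<mu> (\<lambda>x. (u x)\<^sup>2) \<le> qform u u"
    by (rule spectral_gap_E1_perp) blast
  define m where "m = Min (range (\<lambda>x. ln (\<mu> x * h x)))"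
  have coercive: "c / 2 * vint \<mu> (\<lambda>x. (u x)\<^sup>2) - \<beta> * m \<le> ?J u" if u: "u \<in> E1_perp E w \<mu>" for u
  proof -
    obtain x where "0 \<le> u x"
      using mean_zero_nonneg_vertex u by (auto simp: E1_perp_eq)
    moreover have "m \<le> ln (\<mu> x * h x)"
      by (simp add: m_def)
    ultimately have "m \<le> ln (vint \<mu> (\<lambda>x. h x * exp (u x)))"
      using ln_partition_ge[of h x u] h by simp
    then have "- \<beta> * m \<le> - \<beta> * ln (vint \<mu> (\<lambda>x. h x * exp (u x)))"
      using \<open>\<beta> < 0\<close> by (intro mult_left_mono) auto
    then show ?thesis
      using c(2)[OF u] by (simp add: J_eq)
  qed
  have cont: "continuous_on UNIV ?J"
  proof -
    have "vint \<mu> (\<lambda>x. h x * exp (u x)) \<noteq> 0" for u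
      using vint_pos[of "\<lambda>x. h x * exp (u x)"] h by (simp add: less_imp_neq[symmetric])
    then show ?thesis
      unfolding J_eq[abs_def]
      by (intro continuous_intros continuous_vint continuous_qform continuous_coordinate) auto
  qed
  define S where "S = {u \<in> E1_perp E w \<mu>. ?J u \<le> ?J (\<lambda>x. 0)}"
  have "closed S"
    unfolding S_def Collect_conj_eq Collect_mem_eq
    by (intro closed_Int closed_E1_perp closed_Collect_le cont continuous_intros)
  moreover have "S \<noteq> {}"
    using zero_in_E1_perp by (auto simp: S_def)
  moreover have "vint \<mu> (\<lambda>x. (u x)\<^sup>2) \<le> (?J (\<lambda>x. 0) + \<beta> * m) * 2 / c" if "u \<in> S" for u
    using coercive[of u] that c(1) by (simp add: S_def field_simps)
  ultimately obtain u where u: "u \<in> S" "\<And>v. v \<in> S \<Longrightarrow> ?J u \<le> ?J v"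
    using attains_min_square_bounded[OF _ _ _ cont] by blast
  have "?J u \<le> ?J v" if "v \<in> E1_perp E w \<mu>" for v
    using u that by (cases "v \<in> S") (auto simp: S_def)
  then show thesis
    using that u(1) by (auto simp: S_def)
qed

lemma euler_lagrange_weak:
  assumes h: "\<And>x. 0 < h x"
    and u: "u \<in> E1_perp E w \<mu>" "\<And>v. v \<in> E1_perp E w \<mu> \<Longrightarrow> J E w \<mu> h lam \<beta> u \<le> J E w \<mu> h lam \<beta> v"
    and \<psi>: "\<psi> \<in> E1_perp E w \<mu>"
  shows "qform u \<psi> - \<beta> * (vint \<mu> (\<lambda>x. h x * exp (u x) * \<psi> x) / vint \<mu> (\<lambda>x. h x * exp (u x))) = 0"
proof -
  define Z where "Z t = vint \<mu> (\<lambda>x. h x * exp (u x + t * \<psi> x))" for t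
  have Z: "0 < Z t" for t
    unfolding Z_def by (rule vint_pos) (simp add: h)
  have "(Z has_real_derivative vint \<mu> (\<lambda>x. h x * exp (u x) * \<psi> x)) (at 0)"
    unfolding Z_def[abs_def] vint_def by (auto intro!: derivative_eq_intros sum.cong)
  then have "((\<lambda>t. 1/2 * (qform u u + 2 * t * qform u \<psi> + t\<^sup>2 * qform \<psi> \<psi>) - \<beta> * ln (Z t))
      has_real_derivative qform u \<psi> - \<beta> * (vint \<mu> (\<lambda>x. h x * exp (u x) * \<psi> x) / Z 0)) (at 0)"
    using Z[of 0] by (auto intro!: derivative_eq_intros)
  moreover have "J E w \<mu> h lam \<beta> (\<lambda>x. u x + t * \<psi> x)
      = 1/2 * (qform u u + 2 * t * qform u \<psi> + t\<^sup>2 * qform \<psi> \<psi>) - \<beta> * ln (Z t)" for t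
    by (simp add: J_eq qform_expand Z_def)
  ultimately have "((\<lambda>t. J E w \<mu> h lam \<beta> (\<lambda>x. u x + t * \<psi> x))
      has_real_derivative qform u \<psi> - \<beta> * (vint \<mu> (\<lambda>x. h x * exp (u x) * \<psi> x) / Z 0)) (at 0)"
    by simp
  from DERIV_local_min[OF this, of 1] show ?thesis
    using u E1_perp_add[OF u(1) \<psi>] by (simp add: Z_def)
qed

text \<open>
  Constants and first eigenfunctions span the orthogonal complement of \<open>E1_perp\<close>. The remainder \<open>r\<close>
  of the projection of \<open>g\<close> onto their span lies in \<open>E1_perp\<close>, so it is orthogonal both to \<open>g\<close> and to
  the projection, hence to itself.
\<close>

lemma orthogonal_to_E1_perp_expansion:
  assumes basis: "orthonormal_basis \<mu> (E1 E w \<mu>) n b"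
    and orth: "\<And>\<psi>. \<psi> \<in> E1_perp E w \<mu> \<Longrightarrow> vint \<mu> (\<lambda>x. g x * \<psi> x) = 0"
  shows "g x = vint \<mu> g / vol \<mu> + (\<Sum>i=1..n. vint \<mu> (\<lambda>y. g y * b i y) * b i x)"
proof -
  have b_E1: "b i \<in> E1 E w \<mu>" if "i \<in> {1..n}" for i
    using basis that by (simp add: orthonormal_basis_def)
  have b_orth: "vint \<mu> (\<lambda>x. b i x * b j x) = (if i = j then 1 else 0)"
    if "i \<in> {1..n}" "j \<in> {1..n}" for i j
    using basis that by (simp add: orthonormal_basis_def)
  define k where "k i = vint \<mu> (\<lambda>y. g y * b i y)" for i
  define r where "r x = g x - vint \<mu> g / vol \<mu> - (\<Sum>i=1..n. k i * b i x)" for x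
  have mean: "vint \<mu> r = 0"
    using vol_pos by (simp add: r_def[abs_def] vint_linear vint_const vint_sum E1_mean_zero b_E1)
  have r_basis: "vint \<mu> (\<lambda>x. r x * b j x) = 0" if j: "j \<in> {1..n}" for j
  proof -
    have "vint \<mu> (\<lambda>x. r x * b j x)
        = k j - vint \<mu> g / vol \<mu> * vint \<mu> (b j) - (\<Sum>i=1..n. k i * vint \<mu> (\<lambda>x. b i x * b j x))"
      by (simp add: r_def k_def left_diff_distrib sum_distrib_right mult.assoc vint_linear vint_sum
          del: times_divide_eq_left)
    also have "(\<Sum>i=1..n. k i * vint \<mu> (\<lambda>x. b i x * b j x)) = (\<Sum>i=1..n. if i = j then k i else 0)"
      using b_orth j by (intro sum.cong) auto
    also have "\<dots> = k j"
      using j by simp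
    finally show ?thesis
      using b_E1[OF j] E1_mean_zero by simp
  qed
  have r_E1: "vint \<mu> (\<lambda>x. r x * v x) = 0" if "v \<in> E1 E w \<mu>" for v
  proof -
    obtain d where d: "\<And>x. v x = (\<Sum>i=1..n. d i * b i x)"
      using basis \<open>v \<in> E1 E w \<mu>\<close> unfolding orthonormal_basis_def by blast
    have "vint \<mu> (\<lambda>x. r x * v x) = (\<Sum>i=1..n. d i * vint \<mu> (\<lambda>x. r x * b i x))"
      by (simp add: d sum_distrib_left mult.left_commute vint_linear vint_sum)
    also have "\<dots> = 0"
      by (intro sum.neutral) (simp add: r_basis)
    finally show ?thesis .
  qed
  have "vint \<mu> (\<lambda>x. (r x)\<^sup>2)
      = vint \<mu> (\<lambda>x. g x * r x) - vint \<mu> g / vol \<mu> * vint \<mu> r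
        - (\<Sum>i=1..n. k i * vint \<mu> (\<lambda>x. r x * b i x))"
  proof -
    have "(r x)\<^sup>2 = g x * r x - vint \<mu> g / vol \<mu> * r x - (\<Sum>i=1..n. k i * (r x * b i x))" for x
      unfolding power2_eq_square
      by (subst (2) r_def) (simp add: right_diff_distrib sum_distrib_left mult_ac)
    then show ?thesis
      by (simp add: vint_linear vint_sum del: times_divide_eq_left)
  qed
  also have "\<dots> = 0"
    using orth[of r] mean r_E1 r_basis by (simp add: E1_perp_eq)
  finally have "r x = 0"
    by (rule vint_square_eq_0D)
  then show ?thesis
    by (simp add: r_def k_def)
qed

text \<open>
  The expansion is applied to \<open>g = \<Delta>u + \<lambda>u + \<beta> h e\<^sup>u / Z\<close>. The part \<open>\<Delta>u + \<lambda>u\<close> has mean zero and is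
  orthogonal to the eigenfunctions, so only the exponential term contributes to the coefficients;
  its integral is \<open>\<beta>\<close>.
\<close>

lemma kazdan_warner_of_minimizer:
  assumes h: "\<And>x. 0 < h x"
    and basis: "orthonormal_basis \<mu> (E1 E w \<mu>) n b"
    and u: "u \<in> E1_perp E w \<mu>" "\<And>v. v \<in> E1_perp E w \<mu> \<Longrightarrow> J E w \<mu> h lam \<beta> u \<le> J E w \<mu> h lam \<beta> v"
  shows "laplacian E w \<mu> u x + lam * u x =
    - (\<beta> * h x * exp (u x) / vint \<mu> (\<lambda>y. h y * exp (u y))) + \<beta> / vol \<mu>
    + (\<Sum>i=1..n. \<beta> * vint \<mu> (\<lambda>y. h y * b i y * exp (u y)) / vint \<mu> (\<lambda>y. h y * exp (u y)) * b i x)"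
proof -
  define Z where "Z = vint \<mu> (\<lambda>y. h y * exp (u y))"
  have Z: "0 < Z"
    unfolding Z_def by (rule vint_pos) (simp add: h)
  define g where "g x = laplacian E w \<mu> u x + lam * u x + \<beta> / Z * (h x * exp (u x))" for x
  have g: "vint \<mu> (\<lambda>x. g x * \<psi> x) = - qform u \<psi> + \<beta> / Z * vint \<mu> (\<lambda>x. h x * exp (u x) * \<psi> x)" for \<psi>
  proof -
    have "g x * \<psi> x = (laplacian E w \<mu> u x + lam * u x) * \<psi> x + \<beta> / Z * (h x * exp (u x) * \<psi> x)" for x
      by (simp add: g_def algebra_simps)
    then show ?thesis
      by (simp add: qform_eq vint_linear del: times_divide_eq_left)
  qed
  have "vint \<mu> (\<lambda>x. g x * \<psi> x) = 0" if "\<psi> \<in> E1_perp E w \<mu>" for \<psi>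
    using euler_lagrange_weak[OF h u that] by (simp add: g Z_def)
  from orthogonal_to_E1_perp_expansion[OF basis this]
  have "g x = vint \<mu> g / vol \<mu> + (\<Sum>i=1..n. vint \<mu> (\<lambda>y. g y * b i y) * b i x)" .
  moreover have "vint \<mu> g = \<beta>"
  proof -
    have "vint \<mu> g = \<beta> / Z * Z"
      using u(1) vint_laplacian[of u]
      by (simp add: g_def[abs_def] vint_linear E1_perp_eq del: times_divide_eq_left flip: Z_def)
    then show ?thesis
      using Z by simp
  qed
  moreover have "vint \<mu> (\<lambda>y. g y * b i y) = \<beta> * vint \<mu> (\<lambda>y. h y * b i y * exp (u y)) / Z"
    if "i \<in> {1..n}" for i
  proof -
    have "b i \<in> E1 E w \<mu>"
      using basis that by (simp add: orthonormal_basis_def)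
    then have "qform u (b i) = 0"
      using qform_E1 qform_commute by metis
    then show ?thesis
      by (simp add: g mult_ac)
  qed
  ultimately show ?thesis
    by (simp add: g_def Z_def mult.assoc)
qed

lemma J_zero_minimizer:
  "is_arg_min (J E w \<mu> h lam 0) (\<lambda>v. v \<in> mean_zero_space E w \<mu>) (\<lambda>x. 0)"
proof -
  have "qform (\<lambda>x. 0) (\<lambda>x. 0) = 0"
    by (simp add: qform_eq vint_linear)
  then show ?thesis
    using qform_nonneg by (simp add: is_arg_min_linorder mean_zero_space_eq J_eq vint_linear(6))
qed

end

theorem theorem2p3:
  fixes E :: "'v::finite \<Rightarrow> 'v \<Rightarrow> bool"
    and w :: "'v \<Rightarrow> 'v \<Rightarrow> real"
    and \<mu> h :: "'v \<Rightarrow> real"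
    and n1 :: nat
    and u1 :: "nat \<Rightarrow> 'v \<Rightarrow> real"
  assumes "weighted_graph E w \<mu>"
    and "\<And>x. 0 < h x"
    and "orthonormal_basis \<mu> (E1 E w \<mu>) n1 u1"
  shows
    "(\<forall>\<alpha> \<beta>. lambda1 E w \<mu> < \<alpha> \<longrightarrow>
        (INF u \<in> mean_zero_space E w \<mu>. ereal (J E w \<mu> h \<alpha> \<beta> u)) = -\<infinity>) \<and>
     (\<forall>\<beta>>0. (INF u \<in> mean_zero_space E w \<mu>. ereal (J E w \<mu> h (lambda1 E w \<mu>) \<beta> u)) = -\<infinity>) \<and>
     (\<exists>u. is_arg_min (J E w \<mu> h (lambda1 E w \<mu>) 0) (\<lambda>v. v \<in> mean_zero_space E w \<mu>) u \<and>
        (\<forall>x. laplacian E w \<mu> u x + lambda1 E w \<mu> * u x =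
           - (0 * h x * exp (u x) / vint \<mu> (\<lambda>y. h y * exp (u y))) + 0 / vol \<mu>)) \<and>
     (\<forall>\<beta><0. \<exists>u. is_arg_min (J E w \<mu> h (lambda1 E w \<mu>) \<beta>) (\<lambda>v. v \<in> E1_perp E w \<mu>) u \<and>
        (\<forall>x. laplacian E w \<mu> u x + lambda1 E w \<mu> * u x =
           - (\<beta> * h x * exp (u x) / vint \<mu> (\<lambda>y. h y * exp (u y))) + \<beta> / vol \<mu>
           + (\<Sum>i=1..n1. \<beta> * vint \<mu> (\<lambda>y. h y * u1 i y * exp (u y))
                / vint \<mu> (\<lambda>y. h y * exp (u y)) * u1 i x)))"
proof -
  interpret weighted_graph E w \<mu> by (fact assms(1))
  have "\<exists>u. is_arg_min (J E w \<mu> h lam \<beta>) (\<lambda>v. v \<in> E1_perp E w \<mu>) u \<and>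
        (\<forall>x. laplacian E w \<mu> u x + lam * u x =
           - (\<beta> * h x * exp (u x) / vint \<mu> (\<lambda>y. h y * exp (u y))) + \<beta> / vol \<mu>
           + (\<Sum>i=1..n1. \<beta> * vint \<mu> (\<lambda>y. h y * u1 i y * exp (u y))
                / vint \<mu> (\<lambda>y. h y * exp (u y)) * u1 i x))" if neg: "\<beta> < 0" for \<beta>
  proof -
    obtain u where u: "u \<in> E1_perp E w \<mu>"
      "\<And>v. v \<in> E1_perp E w \<mu> \<Longrightarrow> J E w \<mu> h lam \<beta> u \<le> J E w \<mu> h lam \<beta> v"
      by (rule J_attains_min_E1_perp[where h = h, OF assms(2) neg]) blast
    show ?thesis
    proof (intro exI[of _ u] conjI allI)
      show "is_arg_min (J E w \<mu> h lam \<beta>) (\<lambda>v. v \<in> E1_perp E w \<mu>) u"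
        using u by (simp add: is_arg_min_linorder)
    qed (rule kazdan_warner_of_minimizer[where h = h, OF assms(2,3) u])
  qed
  moreover have "\<exists>u. is_arg_min (J E w \<mu> h lam 0) (\<lambda>v. v \<in> mean_zero_space E w \<mu>) u \<and>
        (\<forall>x. laplacian E w \<mu> u x + lam * u x =
           - (0 * h x * exp (u x) / vint \<mu> (\<lambda>y. h y * exp (u y))) + 0 / vol \<mu>)"
    by (intro exI[of _ "\<lambda>x. 0"] conjI J_zero_minimizer) (simp add: laplacian_def)
  ultimately show ?thesis
    by (intro conjI allI impI INF_ereal_eq_minf J_unbounded_supercritical J_unbounded_critical
        assms(2)) simp_all
qed

end
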